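(* Let $p$ be a prime, let $k$ be a positive divisor of $p-1$ with $k\neq 1$, and let $A_k=\{x^k : x\in\mathbb{Z}_p^*\}$ be the group of $k$th powers in $\mathbb{Z}_p^*$. If $A_k=S_1+\cdots+S_n$ for some nonempty subsets $S_1,\dots,S_n$ of $\mathbb{Z}_p$, then $|A_k|=\prod_{i=1}^n|S_i|$.
   Context: $\mathbb{Z}_p$ denotes the finite field of integers modulo the prime $p$, and $\mathbb{Z}_p^*$ its multiplicative group of units. For subsets $S_1,\dots,S_n\subseteq\mathbb{Z}_p$, the sumset is $S_1+\cdots+S_n=\{s_1+\cdots+s_n : s_i\in S_i\}$. *)

theory Defs
  imports "HOL-Number_Theory.Residues"
begin

definition kth_powers :: "('a, 'b) monoid_scheme \<Rightarrow> nat \<Rightarrow> 'a set" where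
  "kth_powers R k = {x [^]\<^bsub>R\<^esub> k | x. x \<in> Units R}"

definition sumset :: "('a, 'b) ring_scheme \<Rightarrow> nat \<Rightarrow> (nat \<Rightarrow> 'a set) \<Rightarrow> 'a set" where
  "sumset R n S = {finsum R s {1..n} | s. s \<in> (\<Pi> i\<in>{1..n}. S i)}"

end

theory Submission
  imports Defs "HOL-Computational_Algebra.Polynomial"
begin

text \<open>
  Write \<open>U\<close> for the group of \<open>k\<close>th powers and \<open>d\<close> for its order. Every residue in \<open>U\<close> is the
  sum of at least one tuple from the product of the \<open>S i\<close>, so the claim says that this tuple is
  unique. It suffices that each coordinate is determined by the sum, hence to consider for each
  \<open>i\<close> the two-term decomposition of \<open>U\<close> into \<open>A = S i\<close> and the set \<open>B\<close> of sums over the other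
  indices. As \<open>A \<times> B\<close> maps onto \<open>U\<close>, uniqueness follows from
  \<open>card A * card B \<le> d\<close>.

  This bound is an instance of the theorem of Hanson and Petridis on sumsets contained in the roots
  of unity (\<open>card_mult_card_le_if_sums_roots_of_unity\<close>), whose proof is Stepanov's method. By
  Lagrange's theorem \<open>(a + b)^d = 1\<close> whenever \<open>a \<in> A\<close> and \<open>b \<in> B\<close>. Put \<open>r = card A\<close> and
  \<open>N = d + r - 1\<close>, and consider the polynomial
  \<open>f = (\<Sum>a\<in>A. c a * (X + a)^N) - 1\<close> modulo \<open>p\<close>, where the weights \<open>c\<close> are chosen such that
  \<open>\<Sum>a\<in>A. c a * q(a)\<close> is the coefficient of degree \<open>r - 1\<close> of \<open>q\<close> for all polynomials \<open>q\<close> of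
  degree below \<open>r\<close>; that is, they are the weights of a divided difference
  (\<open>divided_difference_mod_prime\<close>). The sum defining \<open>f\<close> then has no terms of degree between
  \<open>d + 1\<close> and \<open>N\<close>, and its coefficient of degree \<open>d\<close> is the binomial coefficient of \<open>N\<close> over
  \<open>d\<close>, which is a unit because \<open>N < p\<close>. On the other hand, the expansion of \<open>f\<close> around \<open>b \<in> B\<close>
  has the coefficients \<open>(N choose m) * (\<Sum>a\<in>A. c a * (a + b)^(N - m))\<close>, up to the \<open>-1\<close> for
  \<open>m = 0\<close>. For \<open>m < r\<close> the factor \<open>(a + b)^d\<close> splits off from the power, which leaves
  the exponent \<open>r - 1 - m\<close>, and the choice of \<open>c\<close> makes the coefficient vanish. So \<open>f\<close> has degree
  \<open>d\<close> and a root of order at least \<open>r\<close> at each \<open>b \<in> B\<close>, whence \<open>r * card B \<le> d\<close>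
  (\<open>mod_prime_root_count\<close>).

  The hypothesis \<open>k \<noteq> 1\<close> enters through \<open>N < p\<close>: it gives \<open>d \<le> (p - 1) / 2\<close>, and \<open>r \<le> d\<close> since a
  translate of \<open>A\<close> lies in \<open>U\<close>.

  As \<open>p\<close> is a variable, the field with \<open>p\<close> elements is not a type; the polynomial argument
  takes place among integer polynomials modulo the constant polynomial \<open>p\<close>. Congruence of \<open>f\<close> and \<open>g\<close> is
  written \<open>[:p:] dvd f - g\<close>.
\<close>

section \<open>Comaximal elements modulo a third one\<close>

definition comaximal_mod :: "'a::comm_ring_1 \<Rightarrow> 'a \<Rightarrow> 'a \<Rightarrow> bool" where
  "comaximal_mod m a b \<longleftrightarrow> (\<exists>u v. m dvd u * a + v * b - 1)"

lemma comaximal_mod_commute: "comaximal_mod m a b \<longleftrightarrow> comaximal_mod m b a"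
  unfolding comaximal_mod_def by (metis add.commute)

lemma comaximal_mod_one [simp]: "comaximal_mod m 1 c"
  unfolding comaximal_mod_def by (intro exI[of _ 1] exI[of _ 0]) simp

lemma comaximal_mod_mult:
  assumes "comaximal_mod m a c" and "comaximal_mod m b c"
  shows "comaximal_mod m (a * b) c"
proof -
  obtain u v where uv: "m dvd u * a + v * c - 1"
    using assms(1) unfolding comaximal_mod_def by blast
  obtain s t where st: "m dvd s * b + t * c - 1"
    using assms(2) unfolding comaximal_mod_def by blast
  have "m dvd (u * a + v * c - 1) * (s * b + t * c) + (s * b + t * c - 1)"
    using uv st by (intro dvd_add dvd_mult2)
  also have "\<dots> = (u * s) * (a * b) + (u * a * t + v * s * b + v * t * c) * c - 1"
    by (simp add: algebra_simps)
  finally show ?thesis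
    unfolding comaximal_mod_def by blast
qed

lemma comaximal_mod_power:
  assumes "comaximal_mod m a c"
  shows "comaximal_mod m (a ^ n) c"
  using assms by (induction n) (simp_all add: comaximal_mod_mult)

lemma comaximal_mod_power_power:
  assumes "comaximal_mod m a c"
  shows "comaximal_mod m (a ^ k) (c ^ n)"
  using assms comaximal_mod_power comaximal_mod_commute by metis

lemma comaximal_mod_prod:
  assumes "\<And>b. b \<in> B \<Longrightarrow> comaximal_mod m (q b) c"
  shows "comaximal_mod m (\<Prod>b\<in>B. q b) c"
  using assms by (induction B rule: infinite_finite_induct) (simp_all add: comaximal_mod_mult)

text \<open>
  The Chinese remainder argument: multiplying \<open>f\<close> by a representation
  \<open>u * Q + v * q\<close> of \<open>1\<close> exhibits each summand as a multiple of \<open>Q * q\<close> modulo \<open>m\<close>, since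
  \<open>f\<close> itself supplies the missing factor.
\<close>
lemma comaximal_mod_divisors_mult:
  assumes Q: "m dvd f - Q * h" and q: "m dvd f - q * k" and comax: "comaximal_mod m Q q"
  shows "\<exists>g. m dvd f - (Q * q) * g"
proof -
  obtain u v where uv: "m dvd u * Q + v * q - 1"
    using comax unfolding comaximal_mod_def by blast
  have "m dvd (u * Q) * (f - q * k) + (v * q) * (f - Q * h) - f * (u * Q + v * q - 1)"
    by (intro dvd_diff dvd_add; rule dvd_mult; fact)
  also have "\<dots> = f - (Q * q) * (u * k + v * h)"
    by (simp add: algebra_simps)
  finally show ?thesis by blast
qed

lemma comaximal_mod_divisors_prod:
  assumes "finite B"
    and "\<And>b. b \<in> B \<Longrightarrow> \<exists>h. m dvd f - q b * h"
    and "\<And>b c. b \<in> B \<Longrightarrow> c \<in> B \<Longrightarrow> b \<noteq> c \<Longrightarrow> comaximal_mod m (q b) (q c)"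
  shows "\<exists>h. m dvd f - (\<Prod>b\<in>B. q b) * h"
  using assms
proof (induction B rule: finite_induct)
  case empty
  have "m dvd f - 1 * f" by simp
  then show ?case by (metis prod.empty)
next
  case (insert c B)
  obtain h where h: "m dvd f - (\<Prod>b\<in>B. q b) * h"
    using insert.IH insert.prems by auto
  obtain k where k: "m dvd f - q c * k"
    using insert.prems(1) by auto
  have "comaximal_mod m (\<Prod>b\<in>B. q b) (q c)"
    using insert.prems(2) insert.hyps(2) by (intro comaximal_mod_prod) (metis insertCI)
  from comaximal_mod_divisors_mult[OF h k this] show ?case
    using insert.hyps by (simp add: mult.commute)
qed

section \<open>Roots of integer polynomials modulo a prime\<close>

lemma invertible_mod_prime:
  fixes p x :: int
  assumes "prime p" and "\<not> p dvd x"
  obtains w where "p dvd w * x - 1"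
proof -
  have "coprime x p"
    using assms by (simp add: coprime_commute prime_imp_coprime)
  then obtain w where "[x * w = 1] (mod p)"
    using cong_solve_coprime_int by blast
  then show ?thesis
    using that by (metis cong_iff_dvd_diff mult.commute)
qed

lemma comaximal_mod_linear:
  fixes p b c :: int
  assumes "prime p" and "\<not> p dvd b - c"
  shows "comaximal_mod [:p:] [:-b, 1:] [:-c, 1:]"
proof -
  obtain w where w: "p dvd w * (b - c) - 1"
    using invertible_mod_prime[OF assms] .
  (* The two linear polynomials differ by the constant b - c, which is invertible modulo p. *)
  have "[:- w:] * [:-b, 1:] + [:w:] * [:-c, 1:] - 1 = [:w * (b - c) - 1:]"
    by (simp add: algebra_simps one_pCons)
  with w show ?thesis
    unfolding comaximal_mod_def by (metis const_poly_dvd_const_poly_iff)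
qed

lemma pcompose_power: "(f ^ n) \<circ>\<^sub>p g = (f \<circ>\<^sub>p g) ^ n"
  by (induction n) (simp_all add: pcompose_mult pcompose_1)

text \<open>
  The order of vanishing at \<open>b\<close> is read off from the Taylor coefficients at \<open>b\<close> rather than
  from iterated derivatives, whose values carry factorials. Substituting \<open>X - b\<close> back into the
  truncated expansion gives the multiple of \<open>(X - b)^r\<close>.
\<close>
lemma dvd_shifted_low_coeffs:
  fixes f :: "'a::idom poly"
  assumes "\<And>m. m < r \<Longrightarrow> p dvd coeff (f \<circ>\<^sub>p [:b, 1:]) m"
  shows "\<exists>h. [:p:] dvd f - [:-b, 1:] ^ r * h"
proof -
  define g where "g = f \<circ>\<^sub>p [:b, 1:]"
  have low: "[:p:] dvd poly_cutoff r g"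
    using assms unfolding g_def const_poly_dvd_iff coeff_poly_cutoff by auto
  have split: "g = poly_cutoff r g + monom 1 r * poly_shift r g"
    by (rule poly_eqI) (auto simp: coeff_poly_cutoff coeff_poly_shift coeff_monom_mult)
  have f: "f = g \<circ>\<^sub>p [:-b, 1:]"
    unfolding g_def by (simp add: pcompose_assoc[symmetric] pcompose_pCons pcompose_idR)
  have "f - [:-b, 1:] ^ r * (poly_shift r g \<circ>\<^sub>p [:-b, 1:]) = poly_cutoff r g \<circ>\<^sub>p [:-b, 1:]"
    by (subst f, subst split)
      (simp add: pcompose_add pcompose_mult monom_altdef pcompose_smult pcompose_pCons pcompose_power)
  moreover have "[:p:] dvd poly_cutoff r g \<circ>\<^sub>p [:-b, 1:]"
    using low by (elim dvdE) (simp only: pcompose_mult pcompose_const dvd_triv_left)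
  ultimately show ?thesis by metis
qed

text \<open>
  The degree of \<open>f\<close> modulo \<open>p\<close> is \<open>d\<close>. If \<open>M\<close> is the degree of \<open>h\<close> modulo \<open>p\<close>, which
  exists because \<open>f\<close> does not vanish modulo \<open>p\<close>, then the
  coefficient of degree \<open>degree Q + M\<close> of \<open>Q * h\<close> is that of \<open>h\<close> at \<open>M\<close> modulo \<open>p\<close>, because
  \<open>Q\<close> is monic; so it does not vanish and \<open>degree Q + M \<le> d\<close>.
\<close>
lemma degree_le_if_dvd_diff:
  fixes f Q h :: "int poly"
  assumes p: "prime p" and dvd: "[:p:] dvd f - Q * h" and monic: "lead_coeff Q = 1"
    and top: "\<not> p dvd coeff f d" and high: "\<And>m. m > d \<Longrightarrow> p dvd coeff f m"
  shows "degree Q \<le> d"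
proof -
  have coeff_cong: "p dvd coeff f m \<longleftrightarrow> p dvd coeff (Q * h) m" for m
  proof (rule cong_dvd_iff)
    show "[coeff f m = coeff (Q * h) m] (mod p)"
      using dvd unfolding const_poly_dvd_iff cong_iff_dvd_diff by (metis coeff_diff)
  qed
  define D where "D = (\<lambda>m. \<not> p dvd coeff h m)"
  have bound: "\<forall>m. D m \<longrightarrow> m \<le> degree h"
    unfolding D_def by (auto intro: le_degree)
  have "\<exists>m. D m"
  proof (rule ccontr)
    assume "\<not> ?thesis"
    then have "[:p:] dvd h" unfolding D_def const_poly_dvd_iff by simp
    then have "[:p:] dvd Q * h" by simp
    then have "p dvd coeff (Q * h) d" by (simp add: const_poly_dvd_iff)
    then show False using top coeff_cong by blast
  qed
  then obtain M where M: "D M" "\<And>m. D m \<Longrightarrow> m \<le> M"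
    using bound by (metis GreatestI_nat Greatest_le_nat)
  have "\<not> p dvd coeff (Q * h) (degree Q + M)"
  proof
    assume *: "p dvd coeff (Q * h) (degree Q + M)"
    have others: "p dvd coeff Q i * coeff h (degree Q + M - i)" if "i \<le> degree Q + M" "i \<noteq> degree Q" for i
    proof (cases "i < degree Q")
      case True
      then have "\<not> D (degree Q + M - i)" using M(2) by fastforce
      then show ?thesis unfolding D_def by simp
    next
      case False
      then show ?thesis using that by (simp add: coeff_eq_0)
    qed
    have "coeff (Q * h) (degree Q + M) = coeff Q (degree Q) * coeff h M
        + (\<Sum>i\<in>{..degree Q + M} - {degree Q}. coeff Q i * coeff h (degree Q + M - i))"
      unfolding coeff_mult by (subst sum.remove[of _ "degree Q"]) auto
    moreover have "p dvd (\<Sum>i\<in>{..degree Q + M} - {degree Q}. coeff Q i * coeff h (degree Q + M - i))"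
      using others by (intro dvd_sum) auto
    ultimately have "p dvd coeff h M"
      using * monic by (simp add: dvd_add_left_iff)
    then show False using M(1) unfolding D_def by simp
  qed
  then have "\<not> p dvd coeff f (degree Q + M)"
    using coeff_cong by blast
  then show ?thesis using high by (metis not_le trans_less_add1)
qed

text \<open>
  Roots counted with multiplicity are bounded by the degree: powers of linear factors at distinct
  residues are comaximal, so the product of all of them divides \<open>f\<close> modulo \<open>p\<close>.
\<close>
lemma mod_prime_root_count:
  fixes f :: "int poly"
  assumes p: "prime p" and fin: "finite B"
    and distinct: "\<And>b c. b \<in> B \<Longrightarrow> c \<in> B \<Longrightarrow> b \<noteq> c \<Longrightarrow> \<not> p dvd b - c"
    and roots: "\<And>b m. b \<in> B \<Longrightarrow> m < r \<Longrightarrow> p dvd coeff (f \<circ>\<^sub>p [:b, 1:]) m"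
    and top: "\<not> p dvd coeff f d" and high: "\<And>m. m > d \<Longrightarrow> p dvd coeff f m"
  shows "r * card B \<le> d"
proof -
  define Q where "Q = (\<Prod>b\<in>B. [:-b, 1:] ^ r)"
  have "\<exists>h. [:p:] dvd f - Q * h"
    unfolding Q_def using fin
  proof (rule comaximal_mod_divisors_prod)
    show "\<exists>h. [:p:] dvd f - [:-b, 1:] ^ r * h" if "b \<in> B" for b
      using dvd_shifted_low_coeffs roots that by blast
    show "comaximal_mod [:p:] ([:-b, 1:] ^ r) ([:-c, 1:] ^ r)" if "b \<in> B" "c \<in> B" "b \<noteq> c" for b c
      using that by (intro comaximal_mod_power_power comaximal_mod_linear p distinct)
  qed
  moreover have "lead_coeff Q = 1"
    unfolding Q_def by (simp add: lead_coeff_prod lead_coeff_power)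
  moreover have "degree Q = r * card B"
    unfolding Q_def by (subst degree_prod_eq_sum_degree) (auto simp: degree_power_eq)
  ultimately show ?thesis
    using degree_le_if_dvd_diff[OF p _ _ top high] by metis
qed

section \<open>Stepanov's method\<close>

text \<open>
  The weights are those of the divided difference over the nodes \<open>A\<close>, namely
  \<open>c a = (\<Prod>b\<in>A-{a}. 1 / (a - b))\<close> modulo \<open>p\<close>. They are built up node by node: if \<open>x\<close> is
  added to the nodes \<open>A\<close>, then dividing \<open>q\<close> by \<open>X - x\<close> leaves a quotient \<open>s\<close> whose coefficient of degree \<open>card A - 1\<close>
  is the coefficient of \<open>q\<close> of degree \<open>card A\<close>, and
  \<open>s(a) = (q(a) - q(x)) / (a - x)\<close> on \<open>A\<close>.
\<close>
lemma divided_difference_mod_prime: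
  fixes A :: "int set"
  assumes p: "prime p" and "finite A" and "A \<noteq> {}"
    and "\<And>a b. a \<in> A \<Longrightarrow> b \<in> A \<Longrightarrow> a \<noteq> b \<Longrightarrow> \<not> p dvd a - b"
  shows "\<exists>c. \<forall>q. degree q < card A \<longrightarrow> p dvd (\<Sum>a\<in>A. c a * poly q a) - coeff q (card A - 1)"
  using assms(2-)
proof (induction A rule: finite_ne_induct)
  case (singleton x)
  have "p dvd (\<Sum>a\<in>{x}. 1 * poly q a) - coeff q (card {x} - 1)" if "degree q < card {x}" for q
    using that by (auto elim!: degree_eq_zeroE)
  then show ?case by (intro exI[of _ "\<lambda>_. 1"]) blast
next
  case (insert x A)
  obtain c where c: "\<And>q. degree q < card A \<Longrightarrow> p dvd (\<Sum>a\<in>A. c a * poly q a) - coeff q (card A - 1)"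
    using insert.IH insert.prems by auto
  have "\<forall>a\<in>A. \<exists>w. p dvd w * (a - x) - 1"
    using insert.prems insert.hyps by (metis insertCI invertible_mod_prime[OF p])
  then obtain w where w: "\<And>a. a \<in> A \<Longrightarrow> p dvd w a * (a - x) - 1"
    by metis
  (* The weight of x cancels the total weight on A, so that only differences q(a) - q(x) count. *)
  define e where "e = (\<lambda>a. if a = x then - (\<Sum>a\<in>A. c a * w a) else c a * w a)"
  have "p dvd (\<Sum>a\<in>insert x A. e a * poly q a) - coeff q (card (insert x A) - 1)"
    if deg: "degree q < card (insert x A)" for q
  proof -
    define s where "s = synthetic_div q x"
    have q: "q = [:-x, 1:] * s + [:poly q x:]"
      unfolding s_def by (rule synthetic_div_correct'[symmetric])
    have pos: "card A > 0" using insert.hyps by (simp add: card_gt_0_iff)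
    have degs: "degree s < card A"
      unfolding s_def using deg insert.hyps pos by (simp add: degree_synthetic_div)
    have coeff: "coeff q (card A) = coeff s (card A - 1)"
      using pos degs by (subst q) (cases "card A"; simp add: coeff_eq_0)
    have "(\<Sum>a\<in>insert x A. e a * poly q a)
        = (\<Sum>a\<in>A. c a * w a * poly q a) - (\<Sum>a\<in>A. c a * w a) * poly q x"
      using insert.hyps unfolding e_def by (simp cong: sum.cong_simp) (rule sum.cong; auto)
    also have "\<dots> = (\<Sum>a\<in>A. c a * w a * (poly q a - poly q x))"
      by (simp add: sum_distrib_left sum_subtractf algebra_simps)
    also have "\<dots> = (\<Sum>a\<in>A. c a * poly s a) + (\<Sum>a\<in>A. (w a * (a - x) - 1) * (c a * poly s a))"
    proof -
      have "poly q a - poly q x = (a - x) * poly s a" for a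
        by (subst q) (simp add: algebra_simps)
      then show ?thesis
        unfolding sum.distrib[symmetric] by (intro sum.cong refl) (simp only:, simp add: algebra_simps)
    qed
    finally have "(\<Sum>a\<in>insert x A. e a * poly q a) - coeff q (card (insert x A) - 1)
        = ((\<Sum>a\<in>A. c a * poly s a) - coeff s (card A - 1))
          + (\<Sum>a\<in>A. (w a * (a - x) - 1) * (c a * poly s a))"
      using insert.hyps coeff by simp
    also have "p dvd \<dots>"
      using c[OF degs] w by (intro dvd_add dvd_sum dvd_mult2)
    finally show ?thesis .
  qed
  then show ?case by blast
qed

text \<open>
  The bound of Hanson and Petridis for sets of integers that represent distinct residues. The
  condition \<open>d + card A \<le> p\<close> keeps the leading binomial coefficient of the auxiliary polynomial
  prime to \<open>p\<close>.
\<close>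
lemma card_mult_card_le_if_sums_roots_of_unity:
  fixes A B :: "int set" and p d :: nat
  assumes p: "prime p" and "finite A" and "finite B" and "A \<noteq> {}" and "d > 0"
    and distinctA: "\<And>a b. a \<in> A \<Longrightarrow> b \<in> A \<Longrightarrow> a \<noteq> b \<Longrightarrow> \<not> int p dvd a - b"
    and distinctB: "\<And>a b. a \<in> B \<Longrightarrow> b \<in> B \<Longrightarrow> a \<noteq> b \<Longrightarrow> \<not> int p dvd a - b"
    and unity: "\<And>a b. a \<in> A \<Longrightarrow> b \<in> B \<Longrightarrow> [(a + b) ^ d = 1] (mod int p)"
    and small: "d + card A \<le> p"
  shows "card A * card B \<le> d"
proof -
  define r where "r = card A"
  define N where "N = d + r - 1"
  have pI: "prime (int p)" using p by simp
  have r: "r > 0" unfolding r_def using assms by (simp add: card_gt_0_iff)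
  have N: "N < p" "d \<le> N" "N - d = r - 1" using small r \<open>d > 0\<close> unfolding N_def r_def by auto
  obtain c where c: "\<And>q. degree q < r \<Longrightarrow> int p dvd (\<Sum>a\<in>A. c a * poly q a) - coeff q (r - 1)"
    using divided_difference_mod_prime[OF pI \<open>finite A\<close> \<open>A \<noteq> {}\<close> distinctA] unfolding r_def by metis
  have c_power: "int p dvd (\<Sum>a\<in>A. c a * (a + b) ^ j) - (if j = r - 1 then 1 else 0)" if "j < r" for b j
  proof -
    have "coeff ([:b, 1:] ^ j) (r - 1) = (if j = r - 1 then 1 else 0)"
      using that by (auto simp: coeff_linear_power degree_linear_power intro!: coeff_eq_0)
    then show ?thesis
      using c[of "[:b, 1:] ^ j"] that by (simp add: degree_linear_power add.commute)
  qed
  define f where "f = (\<Sum>a\<in>A. smult (c a) ([:a, 1:] ^ N)) - 1"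
  have shift: "f \<circ>\<^sub>p [:b, 1:] = (\<Sum>a\<in>A. smult (c a) ([:a + b, 1:] ^ N)) - 1" for b
    unfolding f_def
    by (simp add: pcompose_diff pcompose_sum pcompose_smult pcompose_power pcompose_pCons
        pcompose_1 add.commute)
  have coeff_linear: "coeff ([:s, 1:] ^ N) m = int (N choose m) * s ^ (N - m)" for s m
    by (cases "m \<le> N")
      (simp_all add: coeff_linear_poly_power coeff_eq_0 degree_linear_power)
  have coeff_shift: "coeff (f \<circ>\<^sub>p [:b, 1:]) m
      = int (N choose m) * (\<Sum>a\<in>A. c a * (a + b) ^ (N - m)) - (if m = 0 then 1 else 0)" for b m
    unfolding shift
    by (simp add: coeff_sum coeff_linear sum_distrib_left mult_ac)
  have coeff: "coeff f m = int (N choose m) * (\<Sum>a\<in>A. c a * (a + 0) ^ (N - m)) - (if m = 0 then 1 else 0)" for m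
    using coeff_shift[of 0 m] by (simp add: pcompose_idR)
  have "r * card B \<le> d"
  proof (rule mod_prime_root_count[OF pI \<open>finite B\<close> distinctB])
    (* For m < r, the exponent N - m is at least d, so (a + b) ^ d = 1 reduces it to r - 1 - m. *)
    fix b m assume b: "b \<in> B" and m: "m < r"
    have "[(\<Sum>a\<in>A. c a * (a + b) ^ (N - m)) = (\<Sum>a\<in>A. c a * (a + b) ^ (r - 1 - m))] (mod int p)"
    proof (intro cong_sum cong_mult cong_refl)
      fix a assume a: "a \<in> A"
      have "N - m = d + (r - 1 - m)" using m unfolding N_def by simp
      then have "(a + b) ^ (N - m) = (a + b) ^ d * (a + b) ^ (r - 1 - m)"
        by (simp add: power_add)
      then show "[(a + b) ^ (N - m) = (a + b) ^ (r - 1 - m)] (mod int p)"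
        using cong_mult[OF unity[OF a b] cong_refl] by simp
    qed
    also have "[(\<Sum>a\<in>A. c a * (a + b) ^ (r - 1 - m)) = (if m = 0 then 1 else 0)] (mod int p)"
      using c_power[of "r - 1 - m" b] m by (auto simp: cong_iff_dvd_diff split: if_splits)
    finally have "[int (N choose m) * (\<Sum>a\<in>A. c a * (a + b) ^ (N - m))
        = int (N choose m) * (if m = 0 then 1 else 0)] (mod int p)"
      by (intro cong_mult cong_refl)
    then show "int p dvd coeff (f \<circ>\<^sub>p [:b, 1:]) m"
      unfolding coeff_shift by (cases "m = 0") (auto simp: cong_iff_dvd_diff)
  next
    (* The coefficient of degree d is N choose d, as N - d = r - 1. *)
    have "\<not> p dvd N choose d"
    proof
      assume "p dvd N choose d"
      moreover have "N choose d dvd fact N"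
        using binomial_fact_lemma[OF N(2)] by (metis dvd_triv_right)
      ultimately show False
        using prime_dvd_fact_iff[OF p] N(1) by (metis dvd_trans not_le)
    qed
    then have "\<not> int p dvd int (N choose d)" by simp
    moreover have "\<not> int p dvd (\<Sum>a\<in>A. c a * (a + 0) ^ (N - d))"
    proof
      assume *: "int p dvd (\<Sum>a\<in>A. c a * (a + 0) ^ (N - d))"
      have "int p dvd (\<Sum>a\<in>A. c a * (a + 0) ^ (N - d)) - 1"
        using c_power[of "r - 1" 0] r N(3) by simp
      with * have "int p dvd 1" by (metis dvd_diff_right_iff)
      then show False using pI by (simp add: not_prime_unit)
    qed
    ultimately show "\<not> int p dvd coeff f d"
      unfolding coeff using \<open>d > 0\<close> pI by (simp add: prime_dvd_mult_iff)
  next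
    (* Here N - m < r - 1, where the weighted power sums vanish, or else m > N. *)
    fix m assume m: "d < m"
    show "int p dvd coeff f m"
    proof (cases "m \<le> N")
      case True
      then have "N - m < r" "N - m \<noteq> r - 1" using m r unfolding N_def by auto
      then have "int p dvd (\<Sum>a\<in>A. c a * (a + 0) ^ (N - m))"
        using c_power[of "N - m" 0] by simp
      then show ?thesis unfolding coeff using m by simp
    next
      case False
      then show ?thesis unfolding coeff using m by (simp add: binomial_eq_0)
    qed
  qed
  then show ?thesis unfolding r_def .
qed


section \<open>Decompositions of a sumset\<close>

text \<open>
  The sumset for an arbitrary index set, so that one summand can be split off from the others.
\<close>
definition sums_over :: "('a, 'b) ring_scheme \<Rightarrow> 'i set \<Rightarrow> ('i \<Rightarrow> 'a set) \<Rightarrow> 'a set" where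
  "sums_over R I S = {finsum R s I | s. s \<in> Pi I S}"

lemma sumset_eq_sums_over: "sumset R n S = sums_over R {1..n} S"
  by (simp add: sumset_def sums_over_def)

context abelian_group
begin

lemma Pi_imp_funcset_carrier:
  assumes "s \<in> Pi I S" and "\<And>i. i \<in> I \<Longrightarrow> S i \<subseteq> carrier G"
  shows "s \<in> I \<rightarrow> carrier G"
  using assms unfolding Pi_iff by blast

lemma sums_over_subset_carrier:
  assumes "\<And>i. i \<in> I \<Longrightarrow> S i \<subseteq> carrier G"
  shows "sums_over G I S \<subseteq> carrier G"
proof
  fix z assume "z \<in> sums_over G I S"
  then obtain s where s: "s \<in> Pi I S" and z: "z = finsum G s I"
    unfolding sums_over_def by blast
  from s have "s \<in> I \<rightarrow> carrier G"
    by (rule Pi_imp_funcset_carrier) (rule assms)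
  then show "z \<in> carrier G"
    unfolding z by (rule finsum_closed)
qed

lemma sums_over_nonempty:
  assumes "\<And>i. i \<in> I \<Longrightarrow> S i \<noteq> {}"
  shows "sums_over G I S \<noteq> {}"
proof -
  have "(\<lambda>i. SOME x. x \<in> S i) \<in> Pi I S"
    using assms unfolding Pi_iff some_in_eq by blast
  then show ?thesis unfolding sums_over_def by blast
qed

lemma finsum_remove:
  assumes "finite I" and "i \<in> I" and "s \<in> I \<rightarrow> carrier G"
  shows "finsum G s I = s i \<oplus> finsum G s (I - {i})"
proof -
  have "finsum G s (insert i (I - {i})) = s i \<oplus> finsum G s (I - {i})"
    using assms by (intro finsum_insert) auto
  then show ?thesis using assms(2) by (simp only: insert_Diff)
qed

lemma sums_over_remove:
  assumes I: "finite I" "i \<in> I" and S: "\<And>i. i \<in> I \<Longrightarrow> S i \<subseteq> carrier G"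
  shows "(\<lambda>(x, y). x \<oplus> y) ` (S i \<times> sums_over G (I - {i}) S) = sums_over G I S"
proof (intro equalityI subsetI)
  fix z assume "z \<in> (\<lambda>(x, y). x \<oplus> y) ` (S i \<times> sums_over G (I - {i}) S)"
  then obtain x y where x: "x \<in> S i" and y: "y \<in> sums_over G (I - {i}) S" and "z = x \<oplus> y"
    by (elim imageE SigmaE) simp
  moreover from y obtain s where s: "s \<in> Pi (I - {i}) S" and "y = finsum G s (I - {i})"
    unfolding sums_over_def by blast
  ultimately have z: "z = x \<oplus> finsum G s (I - {i})" by simp
  have upd: "s(i := x) \<in> Pi I S" using x s by auto
  then have upd': "s(i := x) \<in> I \<rightarrow> carrier G"
    by (rule Pi_imp_funcset_carrier) (rule S)
  have "finsum G (s(i := x)) (I - {i}) = finsum G s (I - {i})"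
  proof (rule finsum_cong'[OF refl])
    show "s \<in> I - {i} \<rightarrow> carrier G"
      using s by (rule Pi_imp_funcset_carrier) (simp add: S)
  qed simp
  then have "finsum G (s(i := x)) I = z"
    using finsum_remove[OF I upd'] z by simp
  then show "z \<in> sums_over G I S"
    unfolding sums_over_def using upd by blast
next
  fix z assume "z \<in> sums_over G I S"
  then obtain s where s: "s \<in> Pi I S" and z: "z = finsum G s I"
    unfolding sums_over_def by blast
  from s have "s \<in> I \<rightarrow> carrier G"
    by (rule Pi_imp_funcset_carrier) (rule S)
  then have "z = s i \<oplus> finsum G s (I - {i})"
    using finsum_remove[OF I] z by simp
  moreover have "s i \<in> S i" "finsum G s (I - {i}) \<in> sums_over G (I - {i}) S"
    using s I unfolding sums_over_def by auto
  ultimately show "z \<in> (\<lambda>(x, y). x \<oplus> y) ` (S i \<times> sums_over G (I - {i}) S)"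
    by force
qed

text \<open>
  By hypothesis no sum is represented twice in \<open>S i + (\<Sum>j\<noteq>i. S j)\<close>, so the \<open>i\<close>th term of a
  representation depends only on its total. Since this holds for every \<open>i\<close>, the whole tuple
  is determined by its sum.
\<close>
lemma card_sums_over_eq_prod:
  assumes I: "finite I" and S: "\<And>i. i \<in> I \<Longrightarrow> S i \<subseteq> carrier G"
    and fin: "finite (carrier G)"
    and le: "\<And>i. i \<in> I \<Longrightarrow> card (S i) * card (sums_over G (I - {i}) S) \<le> card (sums_over G I S)"
  shows "card (sums_over G I S) = (\<Prod>i\<in>I. card (S i))"
proof -
  have split_inj: "inj_on (\<lambda>(x, y). x \<oplus> y) (S i \<times> sums_over G (I - {i}) S)" if i: "i \<in> I" for i
  proof (rule eq_card_imp_inj_on)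
    have "sums_over G (I - {i}) S \<subseteq> carrier G"
      using S by (intro sums_over_subset_carrier) auto
    then show "finite (S i \<times> sums_over G (I - {i}) S)"
      using S[OF i] fin by (auto intro: finite_subset)
    then have "card ((\<lambda>(x, y). x \<oplus> y) ` (S i \<times> sums_over G (I - {i}) S))
        \<le> card (S i \<times> sums_over G (I - {i}) S)"
      by (rule card_image_le)
    then show "card ((\<lambda>(x, y). x \<oplus> y) ` (S i \<times> sums_over G (I - {i}) S))
        = card (S i \<times> sums_over G (I - {i}) S)"
      using le[OF i] sums_over_remove[where S = S, OF I i S] by (simp add: card_cartesian_product)
  qed
  have "inj_on (\<lambda>s. finsum G s I) (Pi\<^sub>E I S)"
  proof (rule inj_onI)
    fix s t assume s: "s \<in> Pi\<^sub>E I S" and t: "t \<in> Pi\<^sub>E I S" and eq: "finsum G s I = finsum G t I"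
    show "s = t"
    proof (rule PiE_ext[OF s t])
      fix i assume i: "i \<in> I"
      have "s \<in> I \<rightarrow> carrier G" "t \<in> I \<rightarrow> carrier G"
        using s t S by (auto simp: PiE_def intro!: Pi_imp_funcset_carrier)
      then have "s i \<oplus> finsum G s (I - {i}) = t i \<oplus> finsum G t (I - {i})"
        using eq finsum_remove[OF I i] by metis
      moreover have pair: "(r i, finsum G r (I - {i})) \<in> S i \<times> sums_over G (I - {i}) S"
        if r: "r \<in> Pi\<^sub>E I S" for r
      proof -
        have "r i \<in> S i" "r \<in> Pi (I - {i}) S" using r i by auto
        then show ?thesis unfolding sums_over_def by blast
      qed
      ultimately have "(s i, finsum G s (I - {i})) = (t i, finsum G t (I - {i}))"
        by (intro inj_onD[OF split_inj[OF i] _ pair[OF s] pair[OF t]]) simp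
      then show "s i = t i" by simp
    qed
  qed
  moreover have "(\<lambda>s. finsum G s I) ` (Pi\<^sub>E I S) = sums_over G I S"
  proof (intro equalityI subsetI)
    fix z assume "z \<in> sums_over G I S"
    then obtain s where s: "s \<in> Pi I S" and z: "z = finsum G s I"
      unfolding sums_over_def by blast
    have "finsum G (restrict s I) I = finsum G s I"
    proof (rule finsum_cong'[OF refl])
      show "s \<in> I \<rightarrow> carrier G"
        using s by (rule Pi_imp_funcset_carrier) (rule S)
    qed simp
    then show "z \<in> (\<lambda>s. finsum G s I) ` (Pi\<^sub>E I S)"
      using s z by (intro image_eqI[of _ _ "restrict s I"]) simp_all
  qed (auto simp: sums_over_def PiE_def)
  ultimately have "card (sums_over G I S) = card (Pi\<^sub>E I S)"
    by (metis card_image)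
  then show ?thesis using I by (simp add: card_PiE)
qed

end

section \<open>The group of powers\<close>

lemma (in comm_monoid) kth_powers_subgroup:
  fixes k :: nat
  shows "subgroup (kth_powers G k) (units_of G)"
proof -
  interpret U: comm_group "units_of G" by (rule units_comm_group)
  have "(\<lambda>x. x [^]\<^bsub>units_of G\<^esub> k) \<in> hom (units_of G) (units_of G)"
    by (auto simp: hom_def U.nat_pow_distrib)
  then interpret group_hom "units_of G" "units_of G" "\<lambda>x. x [^]\<^bsub>units_of G\<^esub> k"
    by unfold_locales
  have "kth_powers G k = (\<lambda>x. x [^]\<^bsub>units_of G\<^esub> k) ` carrier (units_of G)"
    by (auto simp: kth_powers_def units_of_carrier units_of_pow)
  then show ?thesis using img_is_subgroup by simp
qed

lemma (in comm_monoid) pow_card_kth_powers: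
  fixes k :: nat
  assumes "y \<in> kth_powers G k"
  shows "y [^] card (kth_powers G k) = \<one>"
proof -
  let ?H = "kth_powers G k"
  interpret U: comm_group "units_of G" by (rule units_comm_group)
  interpret H: group "(units_of G)\<lparr>carrier := ?H\<rparr>"
    using U.subgroup_imp_group[OF kth_powers_subgroup] .
  have "y [^]\<^bsub>units_of G\<lparr>carrier := ?H\<rparr>\<^esub> Coset.order (units_of G\<lparr>carrier := ?H\<rparr>) = \<one>\<^bsub>units_of G\<^esub>"
    using H.pow_order_eq_1 assms by simp
  moreover have "y \<in> Units G"
    using assms subgroup.subset[OF kth_powers_subgroup] by (auto simp: units_of_carrier)
  ultimately show ?thesis
    by (simp add: Coset.order_def U.nat_pow_consistent[symmetric] units_of_one units_of_pow)
qed

text \<open>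
  The \<open>k\<close>th powers of units are roots of \<open>X^m - 1\<close>.
\<close>
lemma (in field) card_kth_powers_le:
  assumes "finite (carrier R)" and "k * m = card (Units R)" and "m \<noteq> 0"
  shows "card (kth_powers R k) \<le> m"
proof -
  have "kth_powers R k \<subseteq> {x \<in> carrier R. x [^] m = \<one>}"
  proof
    fix y assume "y \<in> kth_powers R k"
    then obtain x where x: "x \<in> Units R" "y = x [^] k" unfolding kth_powers_def by blast
    then have "y [^] m = x [^] card (Units R)"
      using assms(2) by (simp add: nat_pow_pow Units_closed)
    also have "\<dots> = \<one>"
      using x assms(1) finite_ring_finite_units units_power_order_eq_one by blast
    finally show "y \<in> {x \<in> carrier R. x [^] m = \<one>}"
      using x by (simp add: Units_closed)
  qed
  then have "card (kth_powers R k) \<le> card {x \<in> carrier R. x [^] m = \<one>}"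
    using assms(1) by (intro card_mono) auto
  also have "\<dots> \<le> m"
    using num_roots_le_deg assms by blast
  finally show ?thesis .
qed

lemma (in residues_prime) card_mult_card_le_kth_powers:
  assumes k: "0 < k" "k dvd p - 1" "k \<noteq> 1"
    and A: "A \<subseteq> carrier R" "A \<noteq> {}" and B: "B \<subseteq> carrier R" "B \<noteq> {}"
    and sums: "\<And>a b. a \<in> A \<Longrightarrow> b \<in> B \<Longrightarrow> a \<oplus> b \<in> kth_powers R k"
  shows "card A * card B \<le> card (kth_powers R k)"
proof -
  define d where "d = card (kth_powers R k)"
  have p: "p > 1" using p_prime prime_gt_1_nat by blast
  have kth_carrier: "kth_powers R k \<subseteq> carrier R"
    unfolding kth_powers_def by (auto simp: Units_closed)
  then have fin: "finite (kth_powers R k)" by (rule finite_subset) simp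
  have distinct: "\<not> int p dvd a - b" if "a \<in> carrier R" "b \<in> carrier R" "a \<noteq> b" for a b
    using that unfolding res_carrier_eq
    by (metis atLeastAtMost_iff mod_eq_dvd_iff mod_pos_pos_trivial zle_diff1_eq)
  (* Since k is at least 2, the group of kth powers has at most (p - 1) / 2 elements. *)
  have "2 * d < p"
  proof -
    obtain m where m: "p - 1 = k * m" using k(2) by (rule dvdE)
    have "d \<le> m" unfolding d_def
    proof (rule card_kth_powers_le)
      show "k * m = card (Units R)"
        using m by (simp add: res_prime_units_eq flip: of_nat_mult)
      show "m \<noteq> 0" using m p by (intro notI) simp
    qed simp
    moreover have "2 * m \<le> k * m" using k by (intro mult_le_mono1) simp
    ultimately show ?thesis using m p by linarith
  qed
  moreover have "card A \<le> d"
  proof -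
    obtain b where b: "b \<in> B" using B(2) by blast
    have "inj_on (\<lambda>a. a \<oplus> b) A"
      using A(1) B(1) b by (intro inj_onI) (metis add.right_cancel subsetD)
    then show ?thesis unfolding d_def
      using sums b fin by (intro card_inj_on_le[of "\<lambda>a. a \<oplus> b"]) auto
  qed
  ultimately have small: "d + card A \<le> p" by linarith
  have finA: "finite A" and finB: "finite B"
    using A(1) B(1) by (auto intro: finite_subset)
  have "d > 0"
    using \<open>card A \<le> d\<close> finA A(2) by (metis card_gt_0_iff less_le_trans)
  have unity: "[(a + b) ^ d = 1] (mod int p)" if "a \<in> A" "b \<in> B" for a b
  proof -
    have "(a \<oplus> b) [^] d = \<one>"
      using sums[OF that] pow_card_kth_powers unfolding d_def by blast
    then show ?thesis
      unfolding res_add_eq pow_cong by (simp add: one_cong cong_def)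
  qed
  show ?thesis
    unfolding d_def[symmetric]
    using card_mult_card_le_if_sums_roots_of_unity[OF p_prime finA finB A(2) \<open>d > 0\<close> _ _ unity small]
      distinct A(1) B(1) by (meson subsetD)
qed

theorem corollary4p1:
  fixes p k n :: nat
    and S :: "nat \<Rightarrow> int set"
  assumes "prime p"
    and "0 < k" and "k dvd p - 1" and "k \<noteq> 1"
    and "1 \<le> n"
    and "\<And>i. i \<in> {1..n} \<Longrightarrow> S i \<subseteq> carrier (residue_ring (int p))"
    and "\<And>i. i \<in> {1..n} \<Longrightarrow> S i \<noteq> {}"
    and "kth_powers (residue_ring (int p)) k = sumset (residue_ring (int p)) n S"
  shows "card (kth_powers (residue_ring (int p)) k) = (\<Prod>i=1..n. card (S i))"
proof -
  interpret residues_prime p "residue_ring (int p)"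
    by (simp_all add: residues_prime_def assms(1))
  let ?R = "residue_ring (int p)" and ?I = "{1..n}"
  have U: "kth_powers ?R k = sums_over ?R ?I S"
    using assms(8) by (simp add: sumset_eq_sums_over)
  show ?thesis
    unfolding U
  proof (rule card_sums_over_eq_prod)
    fix i assume i: "i \<in> ?I"
    show "card (S i) * card (sums_over ?R (?I - {i}) S) \<le> card (sums_over ?R ?I S)"
      unfolding U[symmetric]
    proof (rule card_mult_card_le_kth_powers[OF assms(2-4) assms(6,7)[OF i]])
      show "sums_over ?R (?I - {i}) S \<subseteq> carrier ?R"
        using assms(6) by (intro sums_over_subset_carrier) auto
      show "sums_over ?R (?I - {i}) S \<noteq> {}"
        using assms(7) by (intro sums_over_nonempty) auto
      show "a \<oplus>\<^bsub>?R\<^esub> b \<in> kth_powers ?R k" if "a \<in> S i" "b \<in> sums_over ?R (?I - {i}) S" for a b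
        using sums_over_remove[of ?I i S] assms(6) i that unfolding U by force
    qed
  qed (use assms(6) in auto)
qed

end
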